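(* Consider a checkpoint $\theta\in\mathbb{R}^D$ and a neighbourhood of it where the score $S=-L_\tau$ satisfies $S(\theta+\delta)-S(\theta)=a^\top\delta+\mathcal{O}(\|\delta\|^2)$ for a fixed useful direction $a\in\mathbb{R}^D$. Sample $\delta_1,\dots,\delta_N\sim\mathcal{N}(0,\sigma^2 I)$ i.i.d. and select $\delta_{n^\star}=\arg\max_n a^\top\delta_n$ (the sample, among the $N$ drawn, with the largest value of $a^\top\delta_n$). Then: (1) each projection $a^\top\delta_n$ is centred Gaussian with variance $\sigma^2\|a\|^2$, independent of the ambient dimension $D$; (2) the expected best-of-$N$ gain is $\mathbb{E}\left[\max_{n\le N}a^\top\delta_n\right]=\sigma\|a\|\sqrt{2\log N}\,(1+o(1))$, growing in the budget $N$ but not in $D$; (3) for any $b\perp a$ (an unrelated side-task direction), the selected sample has $\mathbb{E}[b^\top\delta_{n^\star}]=0$ and typical magnitude $|b^\top\delta_{n^\star}|=\mathcal{O}(\sigma\|b\|)$, independent of $N$.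
   Context: $L_\tau$ is the loss of a task $\tau$ as a function of the network parameters in $\mathbb{R}^D$; a checkpoint $\theta$ is a parameter vector; the useful direction is $a=-\nabla L_\tau(\theta)$, the direction that most improves the task to first order. $\|\cdot\|$ is the Euclidean norm, $I$ is the $D\times D$ identity matrix, $\sigma$ is the perturbation scale, and $N$ is the number of sampled perturbations (the search budget). The $o(1)$ in (2) is as $N\to\infty$. "Typical magnitude" in (3) is the paper's wording and is not quantified further in the statement. *)

theory Defs
  imports "HOL-Probability.Probability" "HOL-Library.Landau_Symbols"
begin

definition mvn_density :: "real^'d \<Rightarrow> real^'d^'d \<Rightarrow> real^'d \<Rightarrow> real" where
  "mvn_density \<mu> \<Sigma> x =
     exp (- ((x - \<mu>) \<bullet> (matrix_inv \<Sigma> *v (x - \<mu>))) / 2)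
       / sqrt ((2 * pi) ^ CARD('d) * det \<Sigma>)"

(* The second parameter is the variance. For variance 0 the Gaussian law is the point mass
   at the mean, whereas normal_density with standard deviation 0 is identically 0. *)
definition gaussian_law :: "real \<Rightarrow> real \<Rightarrow> real measure" where
  "gaussian_law m v =
     (if v = 0 then return borel m
      else density lborel (\<lambda>x. ennreal (normal_density m (sqrt v) x)))"

definition iid_perturbations ::
    "'w measure \<Rightarrow> real \<Rightarrow> nat \<Rightarrow> (nat \<Rightarrow> 'w \<Rightarrow> real^'d) \<Rightarrow> bool" where
  "iid_perturbations M \<sigma> N \<delta> \<longleftrightarrow>
     prob_space M \<and>
     prob_space.indep_vars M (\<lambda>_. borel) \<delta> {1..N} \<and>
     (\<forall>n\<in>{1..N}. distributed M lborel (\<delta> n)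
        (\<lambda>x. ennreal (mvn_density 0 (\<sigma>\<^sup>2 *\<^sub>R mat 1) x)))"

definition best_gain :: "real^'d \<Rightarrow> nat \<Rightarrow> (nat \<Rightarrow> 'w \<Rightarrow> real^'d) \<Rightarrow> 'w \<Rightarrow> real" where
  "best_gain a N \<delta> \<omega> = Max ((\<lambda>n. a \<bullet> \<delta> n \<omega>) ` {1..N})"

(* The choice made by arg_max_on among several maximisers depends only on the set of
   maximisers, hence only on the projections onto a. This makes the selection meaningful
   also when a = 0; when a is nonzero, ties have probability 0. *)
definition selected :: "real^'d \<Rightarrow> nat \<Rightarrow> (nat \<Rightarrow> 'w \<Rightarrow> real^'d) \<Rightarrow> 'w \<Rightarrow> real^'d" where
  "selected a N \<delta> \<omega> = \<delta> (arg_max_on (\<lambda>n. a \<bullet> \<delta> n \<omega>) {1..N}) \<omega>"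

end

theory Submission
  imports Defs "HOL-Real_Asymp.Real_Asymp"
begin

text \<open>The law of a perturbation is invariant under orthogonal transformations, so \<open>a\<close> may be rotated
  onto a coordinate axis. Then \<open>a \<bullet> \<delta>\<close> is a multiple of one Gaussian coordinate, and for \<open>b\<close> orthogonal
  to \<open>a\<close> the projection \<open>b \<bullet> \<delta>\<close> depends on the other coordinates only, so it is independent of
  \<open>a \<bullet> \<delta>\<close>. The best gain is thus \<open>\<sigma> * norm a\<close> times the maximum of \<open>N\<close> independent standard normal
  variables, whose expectation is bounded above by exponential moments and below by
  \<open>t * P(max \<ge> t) - 1\<close> for a suitable \<open>t\<close>. The selected index is a function of the projections
  onto \<open>a\<close>, hence independent of each \<open>b \<bullet> \<delta> n\<close>, and so \<open>b \<bullet> \<delta>\<close> at the selected index has the same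
  centred Gaussian law as for a single sample.\<close>

section \<open>Isotropic Gaussian vectors\<close>

lemma nn_integral_lborel_translate:
  fixes g :: "'a::euclidean_space \<Rightarrow> ennreal"
  assumes [measurable]: "g \<in> borel_measurable borel"
  shows "(\<integral>\<^sup>+x. g (c + x) \<partial>lborel) = (\<integral>\<^sup>+x. g x \<partial>lborel)"
proof -
  have "(\<integral>\<^sup>+x. g x \<partial>lborel) = (\<integral>\<^sup>+x. g x \<partial>distr lborel borel ((+) c))"
    by (simp add: lborel_distr_plus)
  also have "\<dots> = (\<integral>\<^sup>+x. g (c + x) \<partial>lborel)"
    by (rule nn_integral_distr) auto
  finally show ?thesis ..
qed

lemma nn_integral_lborel_reflect:
  fixes g :: "'a::euclidean_space \<Rightarrow> ennreal"
  assumes [measurable]: "g \<in> borel_measurable borel"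
  shows "(\<integral>\<^sup>+x. g (c - x) \<partial>lborel) = (\<integral>\<^sup>+x. g x \<partial>lborel)"
proof -
  have "(\<integral>\<^sup>+x. g x \<partial>lborel) = (\<integral>\<^sup>+x. g x \<partial>distr lborel borel (\<lambda>x. c + (-1) *\<^sub>R x))"
    by (subst lborel_affine[of "-1" c]) (auto simp: nn_integral_density)
  also have "\<dots> = (\<integral>\<^sup>+x. g (c - x) \<partial>lborel)"
    by (subst nn_integral_distr) auto
  finally show ?thesis ..
qed

text \<open>The image of \<open>lborel\<close> under \<open>T\<close> is translation invariant, hence a multiple of \<open>lborel\<close> by the
  Fubini argument for uniqueness of Haar measure; the unit ball, which \<open>T\<close> preserves, shows that
  the factor is 1. The change-of-variables theorems of the library do not apply because they
  require a well-ordered index type.\<close>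

lemma distr_lborel_orthogonal:
  fixes T :: "'a::euclidean_space \<Rightarrow> 'a"
  assumes T: "orthogonal_transformation T"
  shows "distr lborel borel T = lborel"
proof (rule measure_eqI)
  have lin: "linear T"
    using T by (rule orthogonal_transformation_linear)
  then have T_meas [measurable]: "T \<in> borel_measurable borel"
    by (intro borel_measurable_continuous_onI linear_continuous_on linear_conv_bounded_linear[THEN iffD1])
  fix A assume "A \<in> sets (distr lborel borel T)"
  then have A [measurable]: "A \<in> sets borel" by simp
  \<comment> \<open>\<open>f\<close> is a test function that is invariant under \<open>T\<close> and
    has positive finite integral; \<open>g\<close> carries the arbitrary set to be compared.\<close>
  define f g :: "'a \<Rightarrow> ennreal" where "f = indicator (ball 0 1)" and "g = indicator A"
  have [measurable]: "f \<in> borel_measurable borel" "g \<in> borel_measurable borel"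
    by (auto simp: f_def g_def intro!: borel_measurable_indicator)
  have fT: "f (T x) = f x" for x
    by (simp add: f_def indicator_def orthogonal_transformation_norm[OF T])
  \<comment> \<open>\<open>T\<close> is onto, so a translation by \<open>y\<close> after
    \<open>T\<close> is a translation by some \<open>z\<close> before it. This moves the shift from
    \<open>g\<close> to \<open>f\<close>; once the integrals are exchanged, \<open>f\<close> rather
    than \<open>g\<close> absorbs the integration over \<open>y\<close>.\<close>
  have shift: "(\<integral>\<^sup>+x. f (T x) * g (T x + y) \<partial>lborel) = (\<integral>\<^sup>+x. f (T x - y) * g (T x) \<partial>lborel)" for y
  proof -
    obtain z where z: "T z = y"
      using orthogonal_transformation_surj[OF T] by (metis surjD)
    have "(\<integral>\<^sup>+x. f (T x - y) * g (T x) \<partial>lborel) = (\<integral>\<^sup>+x. f (T (z + x) - y) * g (T (z + x)) \<partial>lborel)"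
      by (rule nn_integral_lborel_translate[symmetric]) simp
    also have "\<dots> = (\<integral>\<^sup>+x. f (T x) * g (T x + y) \<partial>lborel)"
      by (simp add: linear_add[OF lin] z add.commute)
    finally show ?thesis ..
  qed
  have "(\<integral>\<^sup>+x. f x \<partial>lborel) * (\<integral>\<^sup>+x. g x \<partial>lborel) = (\<integral>\<^sup>+x. (\<integral>\<^sup>+y. f (T x) * g (T x + y) \<partial>lborel) \<partial>lborel)"
    by (simp add: nn_integral_cmult nn_integral_multc nn_integral_lborel_translate fT)
  also have "\<dots> = (\<integral>\<^sup>+y. (\<integral>\<^sup>+x. f (T x) * g (T x + y) \<partial>lborel) \<partial>lborel)"
    by (rule lborel_pair.Fubini'[symmetric]) measurable
  also have "\<dots> = (\<integral>\<^sup>+y. (\<integral>\<^sup>+x. f (T x - y) * g (T x) \<partial>lborel) \<partial>lborel)"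
    by (simp add: shift)
  also have "\<dots> = (\<integral>\<^sup>+x. (\<integral>\<^sup>+y. f (T x - y) * g (T x) \<partial>lborel) \<partial>lborel)"
    by (rule lborel_pair.Fubini') measurable
  also have "\<dots> = (\<integral>\<^sup>+x. f x \<partial>lborel) * (\<integral>\<^sup>+x. g (T x) \<partial>lborel)"
    by (simp add: nn_integral_cmult nn_integral_multc nn_integral_lborel_reflect)
  finally have "emeasure lborel (ball (0 :: 'a) 1) * emeasure lborel A
      = emeasure lborel (ball (0 :: 'a) 1) * emeasure lborel (T -` A)"
    using measurable_sets[OF T_meas A]
    by (simp add: f_def g_def indicator_vimage[symmetric] flip: nn_integral_indicator)
  \<comment> \<open>Cancelling the common factor in \<open>ennreal\<close> requires it to be neither
    0 nor infinite.\<close>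
  moreover have "emeasure lborel (ball (0 :: 'a) 1) \<noteq> 0" "emeasure lborel (ball (0 :: 'a) 1) \<noteq> \<infinity>"
    by (auto simp: emeasure_ball less_imp_neq[OF unit_ball_vol_pos] ennreal_eq_0_iff not_le)
  ultimately show "emeasure (distr lborel borel T) A = emeasure lborel A"
    by (simp add: emeasure_distr ennreal_mult_cancel_left)
qed simp

text \<open>Both ingredients of the law are preserved by \<open>T\<close>: Lebesgue measure by the
  previous lemma, and the density because it depends on the norm alone.\<close>

lemma distributed_orthogonal_transformation:
  fixes X :: "'w \<Rightarrow> 'a::euclidean_space" and T :: "'a \<Rightarrow> 'a" and g :: "real \<Rightarrow> ennreal"
  assumes X: "distributed M lborel X (\<lambda>x. g (norm x))"
    and T: "orthogonal_transformation T"
  shows "distributed M lborel (\<lambda>\<omega>. T (X \<omega>)) (\<lambda>x. g (norm x))"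
proof -
  have meas: "(\<lambda>x. g (norm x)) \<in> borel_measurable (borel :: 'a measure)"
    and X_meas: "X \<in> borel_measurable M"
    and law: "distr M lborel X = density lborel (\<lambda>x. g (norm x))"
    using X by (simp_all add: distributed_def)
  have "linear T"
    using T by (rule orthogonal_transformation_linear)
  then have T_meas [measurable]: "T \<in> borel_measurable borel"
    by (intro borel_measurable_continuous_onI linear_continuous_on linear_conv_bounded_linear[THEN iffD1])
  note X_meas [measurable]
  have "distr M lborel (\<lambda>\<omega>. T (X \<omega>)) = distr (distr M lborel X) lborel T"
    by (subst distr_distr) (auto simp: comp_def)
  also have "\<dots> = distr (density lborel (\<lambda>x. g (norm (T x)))) lborel T"
    by (simp add: law orthogonal_transformation_norm[OF T])
  also have "\<dots> = density (distr lborel lborel T) (\<lambda>x. g (norm x))"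
    by (rule density_distr[symmetric]) (use meas in simp_all)
  also have "distr lborel lborel T = distr lborel borel T"
    by (rule distr_cong) auto
  also have "\<dots> = lborel"
    using T by (rule distr_lborel_orthogonal)
  finally show ?thesis
    using meas by (simp add: distributed_def)
qed

section \<open>The isotropic Gaussian density and its projections\<close>

text \<open>The two forms have different uses: the product yields independent coordinates, and the
  radial form yields invariance under rotation.\<close>

lemma mvn_density_isotropic:
  fixes x :: "real^'n"
  assumes "0 < \<sigma>"
  shows "mvn_density 0 (\<sigma>\<^sup>2 *\<^sub>R mat 1) x = (\<Prod>b\<in>Basis. normal_density 0 \<sigma> (x \<bullet> b))"
    and "mvn_density 0 (\<sigma>\<^sup>2 *\<^sub>R mat 1) x =
      exp (- (norm x)\<^sup>2 / (2 * \<sigma>\<^sup>2)) / sqrt ((2 * pi * \<sigma>\<^sup>2) ^ CARD('n))"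
proof -
  have mul: "(c *\<^sub>R mat 1) ** (d *\<^sub>R mat 1) = (c * d) *\<^sub>R (mat 1 :: real^'n^'n)" for c d :: real
    by (simp add: matrix_scalar_ac scalar_matrix_assoc[symmetric])
  have "invertible (\<sigma>\<^sup>2 *\<^sub>R mat 1 :: real^'n^'n)"
    unfolding invertible_def
    by (rule exI[of _ "inverse (\<sigma>\<^sup>2) *\<^sub>R mat 1"]) (use assms in \<open>simp add: mul\<close>)
  \<comment> \<open>\<open>matrix_inv\<close> is given by a choice operator, so its defining
    equation is first extracted from invertibility and then divided by
    \<open>\<sigma>\<^sup>2\<close>.\<close>
  then have "\<sigma>\<^sup>2 *\<^sub>R matrix_inv (\<sigma>\<^sup>2 *\<^sub>R mat 1) = (mat 1 :: real^'n^'n)"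
    using someI_ex[of "\<lambda>B. (\<sigma>\<^sup>2 *\<^sub>R mat 1) ** B = mat 1 \<and> B ** (\<sigma>\<^sup>2 *\<^sub>R mat 1) = (mat 1 :: real^'n^'n)"]
    by (simp add: matrix_inv_def invertible_def scalar_matrix_assoc[symmetric])
  then have inv: "matrix_inv (\<sigma>\<^sup>2 *\<^sub>R mat 1) = (inverse (\<sigma>\<^sup>2) *\<^sub>R mat 1 :: real^'n^'n)"
    using assms by (metis (no_types) scaleR_scaleR scaleR_one left_inverse zero_less_power less_irrefl)
  have det: "det (\<sigma>\<^sup>2 *\<^sub>R mat 1 :: real^'n^'n) = (\<sigma>\<^sup>2) ^ CARD('n)"
    by (subst det_diagonal) (auto simp: mat_def)
  show 2: "mvn_density 0 (\<sigma>\<^sup>2 *\<^sub>R mat 1) x =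
      exp (- (norm x)\<^sup>2 / (2 * \<sigma>\<^sup>2)) / sqrt ((2 * pi * \<sigma>\<^sup>2) ^ CARD('n))"
    using assms
    by (simp add: mvn_density_def inv det scaleR_matrix_vector_assoc[symmetric] power2_norm_eq_inner
        power_mult_distrib field_simps)
  have "(\<Prod>b\<in>Basis. normal_density 0 \<sigma> (x \<bullet> b))
      = (1 / sqrt (2 * pi * \<sigma>\<^sup>2)) ^ CARD('n) * exp (\<Sum>b\<in>Basis. - (x \<bullet> b)\<^sup>2 / (2 * \<sigma>\<^sup>2))"
    by (simp add: normal_density_def prod.distrib exp_sum prod_dividef power_one_over)
  also have "(\<Sum>b\<in>Basis. - (x \<bullet> b)\<^sup>2 / (2 * \<sigma>\<^sup>2)) = - (norm x)\<^sup>2 / (2 * \<sigma>\<^sup>2)"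
    unfolding power2_norm_eq_inner
    by (subst euclidean_inner[of x x]) (simp add: sum_divide_distrib sum_negf power2_eq_square)
  finally show "mvn_density 0 (\<sigma>\<^sup>2 *\<^sub>R mat 1) x = (\<Prod>b\<in>Basis. normal_density 0 \<sigma> (x \<bullet> b))"
    unfolding 2 by (simp add: real_sqrt_power power_one_over)
qed

text \<open>By Tonelli, a product density gives every coordinate box a product of one-dimensional
  integrals. Setting all sides but one to \<open>UNIV\<close> yields the marginals, since each
  \<open>f b\<close> has mass 1, and comparing the two formulas yields independence.\<close>

lemma (in prob_space)
  fixes X :: "'a \<Rightarrow> 'b::euclidean_space"
  assumes X: "distributed M lborel X (\<lambda>x. \<Prod>b\<in>Basis. ennreal (f b (x \<bullet> b)))"
    and f_meas [measurable]: "\<And>b. b \<in> Basis \<Longrightarrow> f b \<in> borel_measurable borel"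
    and f_prob: "\<And>b. b \<in> Basis \<Longrightarrow> (\<integral>\<^sup>+x. ennreal (f b x) \<partial>lborel) = 1"
  shows distributed_Basis_component:
      "\<And>b. b \<in> Basis \<Longrightarrow> distributed M lborel (\<lambda>\<omega>. X \<omega> \<bullet> b) (\<lambda>x. ennreal (f b x))"
    and indep_vars_Basis_components: "indep_vars (\<lambda>_. borel) (\<lambda>b \<omega>. X \<omega> \<bullet> b) Basis"
proof -
  have [measurable]: "X \<in> borel_measurable M"
    using X by (auto simp: distributed_def)
  have joint: "emeasure M (\<Inter>b\<in>Basis. (\<lambda>\<omega>. X \<omega> \<bullet> b) -` A b \<inter> space M)
      = (\<Prod>b\<in>Basis. \<integral>\<^sup>+x. ennreal (f b x) * indicator (A b) x \<partial>lborel)"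
    if A [measurable]: "\<And>b. b \<in> Basis \<Longrightarrow> A b \<in> sets borel" for A
  proof -
    have "(\<Inter>b\<in>Basis. (\<lambda>\<omega>. X \<omega> \<bullet> b) -` A b \<inter> space M)
        = X -` {x. \<forall>b\<in>Basis. x \<bullet> b \<in> A b} \<inter> space M"
      using nonempty_Basis by auto
    also have "emeasure M \<dots> = (\<integral>\<^sup>+x. (\<Prod>b\<in>Basis. ennreal (f b (x \<bullet> b)))
        * indicator {x. \<forall>b\<in>Basis. x \<bullet> b \<in> A b} x \<partial>lborel)"
      by (rule distributed_emeasure[OF X]) measurable
    also have "\<dots> = (\<integral>\<^sup>+x. (\<Prod>b\<in>Basis. ennreal (f b (x \<bullet> b)) * indicator (A b) (x \<bullet> b)) \<partial>lborel)"
      by (intro nn_integral_cong) (auto simp: prod.distrib indicator_def)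
    also have "\<dots> = (\<Prod>b\<in>Basis. \<integral>\<^sup>+x. ennreal (f b x) * indicator (A b) x \<partial>lborel)"
      by (rule nn_integral_lborel_prod) auto
    finally show ?thesis .
  qed
  have single: "emeasure M ((\<lambda>\<omega>. X \<omega> \<bullet> b) -` A \<inter> space M)
      = (\<integral>\<^sup>+x. ennreal (f b x) * indicator A x \<partial>lborel)"
    if b: "b \<in> Basis" and A: "A \<in> sets borel" for b A
  proof -
    have "(\<lambda>\<omega>. X \<omega> \<bullet> b) -` A \<inter> space M
        = (\<Inter>c\<in>Basis. (\<lambda>\<omega>. X \<omega> \<bullet> c) -` (if c = b then A else UNIV) \<inter> space M)"
      using b by (auto split: if_splits)
    also have "emeasure M \<dots>
        = (\<Prod>c\<in>Basis. \<integral>\<^sup>+x. ennreal (f c x) * indicator (if c = b then A else UNIV) x \<partial>lborel)"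
      by (rule joint) (use A in auto)
    also have "\<dots> = (\<Prod>c\<in>Basis. if c = b then \<integral>\<^sup>+x. ennreal (f b x) * indicator A x \<partial>lborel else 1)"
      by (intro prod.cong) (auto simp: f_prob)
    finally show ?thesis
      using b by simp
  qed
  show "distributed M lborel (\<lambda>\<omega>. X \<omega> \<bullet> b) (\<lambda>x. ennreal (f b x))" if b: "b \<in> Basis" for b
    unfolding distributed_def
  proof (intro conjI)
    show "distr M lborel (\<lambda>\<omega>. X \<omega> \<bullet> b) = density lborel (\<lambda>x. ennreal (f b x))"
      by (rule measure_eqI) (use b in \<open>auto simp: emeasure_distr emeasure_density single\<close>)
  qed (use b in auto)
  show "indep_vars (\<lambda>_. borel) (\<lambda>b \<omega>. X \<omega> \<bullet> b) Basis"
  \<comment> \<open>The generating family is all of \<open>sets borel\<close>, which is closed under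
    intersection, so only the product formula for boxes is left.\<close>
  proof (subst indep_vars_finite[where E="\<lambda>_. sets borel"])
    show "\<forall>A\<in>Basis \<rightarrow> sets borel. prob (\<Inter>b\<in>Basis. (\<lambda>\<omega>. X \<omega> \<bullet> b) -` A b \<inter> space M)
        = (\<Prod>b\<in>Basis. prob ((\<lambda>\<omega>. X \<omega> \<bullet> b) -` A b \<inter> space M))"
    proof
      fix A :: "'b \<Rightarrow> real set" assume "A \<in> Basis \<rightarrow> sets borel"
      then have A: "A b \<in> sets borel" if "b \<in> Basis" for b
        using that by auto
      have "ennreal (prob (\<Inter>b\<in>Basis. (\<lambda>\<omega>. X \<omega> \<bullet> b) -` A b \<inter> space M))
          = emeasure M (\<Inter>b\<in>Basis. (\<lambda>\<omega>. X \<omega> \<bullet> b) -` A b \<inter> space M)"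
        by (simp only: emeasure_eq_measure)
      also have "\<dots> = (\<Prod>b\<in>Basis. emeasure M ((\<lambda>\<omega>. X \<omega> \<bullet> b) -` A b \<inter> space M))"
        by (subst joint) (auto simp: A single intro!: prod.cong)
      also have "\<dots> = (\<Prod>b\<in>Basis. ennreal (prob ((\<lambda>\<omega>. X \<omega> \<bullet> b) -` A b \<inter> space M)))"
        by (simp only: emeasure_eq_measure)
      finally show "prob (\<Inter>b\<in>Basis. (\<lambda>\<omega>. X \<omega> \<bullet> b) -` A b \<inter> space M)
          = (\<Prod>b\<in>Basis. prob ((\<lambda>\<omega>. X \<omega> \<bullet> b) -` A b \<inter> space M))"
        by (simp add: prod_ennreal prod_nonneg)
    qed
  qed (auto simp: Int_stable_def sets.sigma_sets_eq[of borel, simplified])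
qed

lemma nn_integral_normal_density:
  assumes "0 < \<sigma>"
  shows "(\<integral>\<^sup>+x. ennreal (normal_density \<mu> \<sigma> x) \<partial>lborel) = 1"
  using assms by (simp add: nn_integral_eq_integral)

text \<open>For \<open>a = 0\<close> the projection is constant and has no density, so that case is
  handled separately wherever this result is applied.\<close>

lemma (in prob_space)
  fixes X :: "'a \<Rightarrow> real^'n"
  assumes X: "distributed M lborel X (\<lambda>x. ennreal (mvn_density 0 (\<sigma>\<^sup>2 *\<^sub>R mat 1) x))"
    and \<sigma>: "0 < \<sigma>"
  shows distributed_inner_isotropic_gaussian:
      "a \<noteq> 0 \<Longrightarrow> distributed M lborel (\<lambda>\<omega>. a \<bullet> X \<omega>) (\<lambda>x. ennreal (normal_density 0 (\<sigma> * norm a) x))"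
    and indep_var_inner_isotropic_gaussian:
      "a \<noteq> 0 \<Longrightarrow> a \<bullet> b = 0 \<Longrightarrow> indep_var borel (\<lambda>\<omega>. a \<bullet> X \<omega>) borel (\<lambda>\<omega>. b \<bullet> X \<omega>)"
proof -
  assume a: "a \<noteq> 0"
  obtain e :: "real^'n" where e: "e \<in> Basis"
    using nonempty_Basis by blast
  have "norm a = norm (norm a *\<^sub>R e)"
    using e by simp
  then obtain T :: "real^'n \<Rightarrow> real^'n" where T: "orthogonal_transformation T" and Ta: "T a = norm a *\<^sub>R e"
    by (rule orthogonal_transformation_exists)
  define Y where "Y \<omega> = T (X \<omega>)" for \<omega>
  \<comment> \<open>\<open>T\<close> preserves inner products, so projections of \<open>X\<close>
    are projections of the rotated vector \<open>Y\<close>, which has the same law.\<close>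
  have inner_Y: "v \<bullet> X \<omega> = T v \<bullet> Y \<omega>" for v \<omega>
    using T by (simp add: Y_def orthogonal_transformation_def)
  have "distributed M lborel Y (\<lambda>x. ennreal (mvn_density 0 (\<sigma>\<^sup>2 *\<^sub>R mat 1) x))"
    using X unfolding Y_def mvn_density_isotropic(2)[OF \<sigma>]
    by (rule distributed_orthogonal_transformation[where
          g="\<lambda>r. ennreal (exp (- r\<^sup>2 / (2 * \<sigma>\<^sup>2)) / sqrt ((2 * pi * \<sigma>\<^sup>2) ^ CARD('n)))"]) (rule T)
  then have Y: "distributed M lborel Y (\<lambda>x. \<Prod>b\<in>Basis. ennreal (normal_density 0 \<sigma> (x \<bullet> b)))"
    by (simp add: mvn_density_isotropic(1)[OF \<sigma>] prod_ennreal)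
  have "distributed M lborel (\<lambda>\<omega>. Y \<omega> \<bullet> e) (\<lambda>x. ennreal (normal_density 0 \<sigma> x))"
    by (rule distributed_Basis_component[OF Y]) (use e \<sigma> in \<open>auto simp: nn_integral_normal_density\<close>)
  from normal_density_affine[OF this, of "norm a" 0]
  show "distributed M lborel (\<lambda>\<omega>. a \<bullet> X \<omega>) (\<lambda>x. ennreal (normal_density 0 (\<sigma> * norm a) x))"
    using a \<sigma> by (simp add: inner_Y Ta inner_commute mult.commute)
  assume ab: "a \<bullet> b = 0"
  have "norm a * (e \<bullet> T b) = 0"
    using ab T Ta unfolding orthogonal_transformation_def by (metis inner_scaleR_left)
  \<comment> \<open>\<open>T b\<close> is orthogonal to \<open>T a\<close> and hence to
    \<open>e\<close>, so \<open>b \<bullet> X\<close> involves only the coordinates of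
    \<open>Y\<close> other than \<open>e\<close>.\<close>
  then have Tb: "T b \<bullet> e = 0"
    using a by (simp add: inner_commute)
  have indep: "indep_vars (\<lambda>_. borel) (\<lambda>b \<omega>. Y \<omega> \<bullet> b) Basis"
    by (rule indep_vars_Basis_components[OF Y]) (use \<sigma> in \<open>auto simp: nn_integral_normal_density\<close>)
  have "indep_var borel ((\<lambda>y. norm a * y e) \<circ> (\<lambda>\<omega>. restrict (\<lambda>b. Y \<omega> \<bullet> b) {e}))
      borel ((\<lambda>y. \<Sum>c\<in>Basis - {e}. (T b \<bullet> c) * y c) \<circ> (\<lambda>\<omega>. restrict (\<lambda>b. Y \<omega> \<bullet> b) (Basis - {e})))"
    by (rule indep_var_compose[OF indep_var_restrict[OF indep]]) (use e in auto)
  also have "(\<lambda>y. norm a * y e) \<circ> (\<lambda>\<omega>. restrict (\<lambda>b. Y \<omega> \<bullet> b) {e}) = (\<lambda>\<omega>. a \<bullet> X \<omega>)"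
    by (auto simp: inner_Y Ta inner_commute)
  also have "(\<lambda>y. \<Sum>c\<in>Basis - {e}. (T b \<bullet> c) * y c) \<circ> (\<lambda>\<omega>. restrict (\<lambda>b. Y \<omega> \<bullet> b) (Basis - {e}))
      = (\<lambda>\<omega>. b \<bullet> X \<omega>)"
  proof
    fix \<omega>
    have "b \<bullet> X \<omega> = (\<Sum>c\<in>Basis. (T b \<bullet> c) * (Y \<omega> \<bullet> c))"
      unfolding inner_Y by (rule euclidean_inner)
    also have "\<dots> = (\<Sum>c\<in>Basis - {e}. (T b \<bullet> c) * (Y \<omega> \<bullet> c))"
      using e by (subst sum.remove[of _ e]) (auto simp: Tb)
    finally show "((\<lambda>y. \<Sum>c\<in>Basis - {e}. (T b \<bullet> c) * y c) \<circ> (\<lambda>\<omega>. restrict (\<lambda>b. Y \<omega> \<bullet> b) (Basis - {e}))) \<omega>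
        = b \<bullet> X \<omega>"
      by simp
  qed
  finally show "indep_var borel (\<lambda>\<omega>. a \<bullet> X \<omega>) borel (\<lambda>\<omega>. b \<bullet> X \<omega>)" .
qed

section \<open>The maximum of standard normal variables\<close>

text \<open>The intended instance is the family of projections onto \<open>a\<close> divided by
  \<open>\<sigma> * norm a\<close>. The analysis of the maximum then involves neither dimension nor
  direction.\<close>

locale std_normal_sample = prob_space M for M :: "'w measure" +
  fixes Z :: "nat \<Rightarrow> 'w \<Rightarrow> real" and N :: nat
  assumes N_pos: "1 \<le> N"
    and indep: "indep_vars (\<lambda>_. borel) Z {1..N}"
    and std_normal: "\<And>n. n \<in> {1..N} \<Longrightarrow> distributed M lborel (Z n) (\<lambda>x. ennreal (std_normal_density x))"
begin

definition Z_max :: "'w \<Rightarrow> real" where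
  "Z_max \<omega> = Max ((\<lambda>n. Z n \<omega>) ` {1..N})"

lemma Z_measurable [measurable]: "n \<in> {1..N} \<Longrightarrow> Z n \<in> borel_measurable M"
  using std_normal by (auto simp: distributed_def)

lemma Z_max_measurable [measurable]: "Z_max \<in> borel_measurable M"
  unfolding Z_max_def[abs_def] by measurable

lemma Z_le_Z_max: "n \<in> {1..N} \<Longrightarrow> Z n \<omega> \<le> Z_max \<omega>"
  unfolding Z_max_def by (intro Max_ge) auto

lemma Z_max_attained:
  obtains n where "n \<in> {1..N}" "Z_max \<omega> = Z n \<omega>"
proof -
  have "Z_max \<omega> \<in> (\<lambda>n. Z n \<omega>) ` {1..N}"
    unfolding Z_max_def using N_pos by (intro Max_in) auto
  then show ?thesis
    using that by auto
qed

section \<open>Moments, and an upper bound for the expected maximum\<close>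

text \<open>The first absolute moment is \<open>sqrt (2 / pi)\<close>. The round bound 1 becomes the
  constant subtracted in the lower bound for the maximum, and it also feeds a Markov
  estimate.\<close>

lemma
  assumes n: "n \<in> {1..N}"
  shows integrable_Z: "integrable M (Z n)"
    and integrable_abs_Z: "integrable M (\<lambda>\<omega>. \<bar>Z n \<omega>\<bar>)"
    and expectation_abs_Z: "expectation (\<lambda>\<omega>. \<bar>Z n \<omega>\<bar>) \<le> 1"
proof -
  note D = std_normal[OF n]
  show "integrable M (Z n)"
    using integrable_std_normal_moment[of 1] by (intro distributed_integrable_var[OF D]) auto
  then show "integrable M (\<lambda>\<omega>. \<bar>Z n \<omega>\<bar>)"
    by (rule integrable_abs)
  have "expectation (\<lambda>\<omega>. \<bar>Z n \<omega>\<bar>) = (\<integral>x. std_normal_density x * \<bar>x\<bar> \<partial>lborel)"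
    using distributed_integral[OF D, of "\<lambda>x. \<bar>x\<bar>"] by simp
  also have "\<dots> = sqrt (2 / pi)"
    using integral_std_normal_moment_abs_odd[of 0] by simp
  also have "\<dots> \<le> 1"
    using pi_gt3 by simp
  finally show "expectation (\<lambda>\<omega>. \<bar>Z n \<omega>\<bar>) \<le> 1" .
qed

lemma
  assumes n: "n \<in> {1..N}"
  shows integrable_exp_Z: "integrable M (\<lambda>\<omega>. exp (s * Z n \<omega>))"
    and expectation_exp_Z: "expectation (\<lambda>\<omega>. exp (s * Z n \<omega>)) = exp (s\<^sup>2 / 2)"
proof -
  note D = std_normal[OF n]
  \<comment> \<open>Completing the square: exponential tilting shifts the mean to
    \<open>s\<close>.\<close>
  have eq: "std_normal_density x * exp (s * x) = exp (s\<^sup>2 / 2) * normal_density s 1 x" for x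
    by (simp add: normal_density_def flip: exp_add) (simp add: power2_eq_square field_simps)
  show "integrable M (\<lambda>\<omega>. exp (s * Z n \<omega>))"
    using distributed_integrable[OF D, of "\<lambda>x. exp (s * x)"] by (simp add: eq)
  show "expectation (\<lambda>\<omega>. exp (s * Z n \<omega>)) = exp (s\<^sup>2 / 2)"
    using distributed_integral[OF D, of "\<lambda>x. exp (s * x)"] by (simp add: eq)
qed

lemma integrable_Z_max: "integrable M Z_max"
proof (rule Bochner_Integration.integrable_bound)
  show "integrable M (\<lambda>\<omega>. \<Sum>n\<in>{1..N}. \<bar>Z n \<omega>\<bar>)"
    by (intro Bochner_Integration.integrable_sum integrable_abs_Z)
  show "AE \<omega> in M. norm (Z_max \<omega>) \<le> norm (\<Sum>n\<in>{1..N}. \<bar>Z n \<omega>\<bar>)"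
  proof (rule AE_I2)
    fix \<omega>
    obtain n where n: "n \<in> {1..N}" "Z_max \<omega> = Z n \<omega>"
      by (rule Z_max_attained)
    have "\<bar>Z n \<omega>\<bar> \<le> (\<Sum>n\<in>{1..N}. \<bar>Z n \<omega>\<bar>)"
      using n(1) by (intro member_le_sum) auto
    then show "norm (Z_max \<omega>) \<le> norm (\<Sum>n\<in>{1..N}. \<bar>Z n \<omega>\<bar>)"
      using n(2) by simp
  qed
qed simp

text \<open>With \<open>s\<^sup>2 = 2 ln N\<close>, the tangent of \<open>exp\<close> at 0 bounds \<open>s * Z_max - s\<^sup>2 + 1\<close> by
  the sum of the \<open>exp (s * Z n - s\<^sup>2)\<close>, whose expectation is 1.\<close>

lemma expectation_Z_max_le: "expectation Z_max \<le> sqrt (2 * ln N)"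
proof (cases "N = 1")
  \<comment> \<open>Here \<open>sqrt (2 * ln N)\<close> is 0 and could not be cancelled as in the
    general argument, but both sides vanish.\<close>
  case True
  have "Z_max = Z 1"
    unfolding Z_max_def[abs_def] by (simp add: True)
  moreover have "expectation (Z 1) = 0"
    by (rule standard_normal_distributed_expectation) (use std_normal True in auto)
  ultimately show ?thesis
    by (simp add: True)
next
  case False
  define s where "s = sqrt (2 * ln N)"
  have s: "0 < s" "s\<^sup>2 = 2 * ln N"
    using N_pos False by (auto simp: s_def)
  have "s * Z_max \<omega> \<le> s\<^sup>2 - 1 + (\<Sum>n\<in>{1..N}. exp (s * Z n \<omega>) * exp (- s\<^sup>2))" for \<omega>
  proof -
    obtain n where n: "n \<in> {1..N}" "Z_max \<omega> = Z n \<omega>"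
      by (rule Z_max_attained)
    have "s * Z n \<omega> - s\<^sup>2 + 1 \<le> exp (s * Z n \<omega> - s\<^sup>2)"
      using exp_ge_add_one_self[of "s * Z n \<omega> - s\<^sup>2"] by linarith
    also have "\<dots> = exp (s * Z n \<omega>) * exp (- s\<^sup>2)"
      by (simp flip: exp_add)
    also have "\<dots> \<le> (\<Sum>n\<in>{1..N}. exp (s * Z n \<omega>) * exp (- s\<^sup>2))"
      using n(1) by (intro member_le_sum) auto
    finally show ?thesis
      using n(2) by simp
  qed
  moreover have int: "integrable M (\<lambda>\<omega>. \<Sum>n\<in>{1..N}. exp (s * Z n \<omega>) * exp (- s\<^sup>2))"
    by (intro Bochner_Integration.integrable_sum integrable_mult_left integrable_exp_Z)
  ultimately have "expectation (\<lambda>\<omega>. s * Z_max \<omega>)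
      \<le> expectation (\<lambda>\<omega>. s\<^sup>2 - 1 + (\<Sum>n\<in>{1..N}. exp (s * Z n \<omega>) * exp (- s\<^sup>2)))"
    by (intro integral_mono Bochner_Integration.integrable_add integrable_mult_right integrable_Z_max) auto
  also have "\<dots> = s\<^sup>2 - 1 + N * exp (s\<^sup>2 / 2) * exp (- s\<^sup>2)"
    by (subst Bochner_Integration.integral_add[OF _ int])
      (auto simp: expectation_exp_Z integrable_exp_Z prob_space simp del: One_nat_def)
  also have "\<dots> = s\<^sup>2"
  proof -
    have "N * exp (s\<^sup>2 / 2) * exp (- s\<^sup>2) = N * exp (- ln N)"
      by (simp add: s(2) mult.assoc flip: exp_add)
    then show ?thesis
      using N_pos by (simp add: exp_minus)
  qed
  finally have "s * expectation Z_max \<le> s * s"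
    by (simp add: power2_eq_square)
  then show ?thesis
    using s(1) by (simp add: s_def[symmetric])
qed

section \<open>A lower bound for the expected maximum\<close>

text \<open>The density decreases on the nonnegative reals, so on the unit interval from
  \<open>t\<close> to \<open>t + 1\<close> it is at least its value at the right end. This costs
  only a shift of \<open>t\<close> by 1, which does not affect the leading asymptotics.\<close>

lemma prob_Z_ge:
  assumes n: "n \<in> {1..N}" and t: "0 \<le> t"
  shows "std_normal_density (t + 1) \<le> prob {\<omega> \<in> space M. t \<le> Z n \<omega>}"
proof -
  have "ennreal (std_normal_density (t + 1)) = (\<integral>\<^sup>+x. ennreal (std_normal_density (t + 1)) * indicator {t..t+1} x \<partial>lborel)"
    by (subst nn_integral_cmult_indicator) auto
  also have "\<dots> \<le> (\<integral>\<^sup>+x. ennreal (std_normal_density x) * indicator {t..} x \<partial>lborel)"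
  proof (rule nn_integral_mono)
    fix x
    have "std_normal_density (t + 1) \<le> std_normal_density x" if "t \<le> x" "x \<le> t + 1"
      using that t by (simp add: normal_density_def divide_right_mono power_mono)
    then show "ennreal (std_normal_density (t + 1)) * indicator {t..t+1} x
        \<le> ennreal (std_normal_density x) * indicator {t..} x"
      by (auto simp: indicator_def intro!: ennreal_leI)
  qed
  also have "\<dots> = emeasure M (Z n -` {t..} \<inter> space M)"
    by (rule distributed_emeasure[OF std_normal[OF n], symmetric]) simp
  also have "Z n -` {t..} \<inter> space M = {\<omega> \<in> space M. t \<le> Z n \<omega>}"
    by auto
  finally show ?thesis
    by (simp add: emeasure_eq_measure)
qed

text \<open>Independence turns the probability into a product, and each factor is bounded by
  \<open>1 - p \<le> exp (- p)\<close> with \<open>p\<close> the tail bound above.\<close>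

lemma prob_Z_max_less:
  assumes t: "0 \<le> t"
  shows "prob {\<omega> \<in> space M. Z_max \<omega> < t} \<le> exp (- (N * std_normal_density (t + 1)))"
proof -
  have "{\<omega> \<in> space M. Z_max \<omega> < t} = (\<Inter>n\<in>{1..N}. Z n -` {..<t} \<inter> space M)"
    using N_pos by (auto simp: Z_max_def)
  also have "prob \<dots> = (\<Prod>n\<in>{1..N}. prob (Z n -` {..<t} \<inter> space M))"
    by (rule indep_varsD_finite[OF indep]) (use N_pos in auto)
  also have "\<dots> \<le> (\<Prod>n\<in>{1..N}. exp (- std_normal_density (t + 1)))"
  proof (intro prod_mono conjI)
    fix n assume n: "n \<in> {1..N}"
    have "prob (Z n -` {..<t} \<inter> space M) = prob (space M - {\<omega> \<in> space M. t \<le> Z n \<omega>})"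
      by (intro arg_cong[where f=prob]) auto
    also have "\<dots> = 1 - prob {\<omega> \<in> space M. t \<le> Z n \<omega>}"
      using n by (intro prob_compl) measurable
    also have "\<dots> \<le> 1 - std_normal_density (t + 1)"
      using prob_Z_ge[OF n t] by simp
    also have "\<dots> \<le> exp (- std_normal_density (t + 1))"
      using exp_ge_add_one_self[of "- std_normal_density (t + 1)"] by simp
    finally show "prob (Z n -` {..<t} \<inter> space M) \<le> exp (- std_normal_density (t + 1))" .
  qed simp
  also have "\<dots> = exp (- (N * std_normal_density (t + 1)))"
    by (simp flip: exp_of_nat_mult)
  finally show ?thesis .
qed

text \<open>The maximum is at least \<open>t\<close> on the event \<open>?A\<close>, and everywhere
  at least \<open>- \<bar>Z 1 \<omega>\<bar>\<close>. The second bound controls the negative part at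
  a cost of at most 1 in expectation.\<close>

lemma expectation_Z_max_ge:
  assumes t: "0 \<le> t"
  shows "t * (1 - exp (- (N * std_normal_density (t + 1)))) - 1 \<le> expectation Z_max"
proof -
  let ?A = "{\<omega> \<in> space M. t \<le> Z_max \<omega>}"
  have 1: "1 \<in> {1..N}"
    using N_pos by simp
  have "prob ?A = 1 - prob {\<omega> \<in> space M. Z_max \<omega> < t}"
  proof -
    have "?A = space M - {\<omega> \<in> space M. Z_max \<omega> < t}"
      by auto
    then show ?thesis
      by (simp add: prob_compl)
  qed
  then have "t * (1 - exp (- (N * std_normal_density (t + 1)))) - 1
      \<le> t * prob ?A - expectation (\<lambda>\<omega>. \<bar>Z 1 \<omega>\<bar>)"
    using prob_Z_max_less[OF t] expectation_abs_Z[OF 1] t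
    by (intro diff_mono mult_left_mono) auto
  also have "\<dots> = expectation (\<lambda>\<omega>. t * indicator ?A \<omega> - \<bar>Z 1 \<omega>\<bar>)"
    using integrable_abs_Z[OF 1] by (subst Bochner_Integration.integral_diff) (auto simp: less_top[symmetric])
  also have "\<dots> \<le> expectation Z_max"
  proof (rule integral_mono)
    fix \<omega>
    show "t * indicator ?A \<omega> - \<bar>Z 1 \<omega>\<bar> \<le> Z_max \<omega>"
      using Z_le_Z_max[OF 1, of \<omega>] by (auto simp: indicator_def)
  qed (use integrable_abs_Z[OF 1] integrable_Z_max in \<open>auto simp: less_top[symmetric]\<close>)
  finally show ?thesis .
qed

text \<open>This \<open>t\<close> makes \<open>N * std_normal_density (t + 1)\<close> equal to \<open>ln N / sqrt (2 * pi)\<close>, which diverges,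
  while \<open>t\<close> is still asymptotic to \<open>sqrt (2 * ln N)\<close>.\<close>

lemma expectation_Z_max_ge_explicit:
  fixes t
  defines "t \<equiv> sqrt (2 * ln N - 2 * ln (ln N)) - 1"
  assumes t: "0 \<le> t" and N: "0 < ln (real N)"
  shows "t * (1 - exp (- (ln N / sqrt (2 * pi)))) - 1 \<le> expectation Z_max"
proof -
  \<comment> \<open>\<open>sqrt\<close> of a negative real is negative, so this inequality ensures
    that the radicand is nonnegative and the square can be evaluated.\<close>
  have "1 \<le> sqrt (2 * ln N - 2 * ln (ln N))"
    using t by (simp add: t_def)
  then have "(t + 1)\<^sup>2 = 2 * ln N - 2 * ln (ln N)"
    by (simp add: t_def)
  then have "- (t + 1)\<^sup>2 / 2 = ln (ln N) - ln N"
    by simp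
  then have "exp (- (t + 1)\<^sup>2 / 2) = ln N / N"
    using N N_pos by (simp add: exp_diff)
  then have "N * std_normal_density (t + 1) = ln N / sqrt (2 * pi)"
    using N_pos by (simp add: std_normal_density_def)
  with expectation_Z_max_ge[OF t] show ?thesis
    by simp
qed

section \<open>Strict growth of the expected maximum with the sample size\<close>

lemma std_normal_subsample:
  assumes "1 \<le> m" "m \<le> N"
  shows "std_normal_sample M Z m"
proof unfold_locales
  show "indep_vars (\<lambda>_. borel) Z {1..m}"
    using indep by (rule indep_vars_subset) (use assms in auto)
qed (use assms std_normal in auto)

text \<open>Enlarging the sample never lowers the maximum, and it raises it strictly on the event
  \<open>A\<close> that \<open>Z N\<close> reaches 2 while the first \<open>m\<close> variables stay
  below 2. By independence \<open>A\<close> has positive probability.\<close>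

lemma expectation_subsample_Max_less:
  assumes m: "1 \<le> m" "m < N"
  shows "expectation (\<lambda>\<omega>. Max ((\<lambda>n. Z n \<omega>) ` {1..m})) < expectation Z_max"
proof -
  interpret sub: std_normal_sample M Z m
    using m by (intro std_normal_subsample) auto
  let ?X = "\<lambda>n. if n = N then {2..} else {..<2} :: real set"
  define A where "A = (\<Inter>n\<in>insert N {1..m}. Z n -` ?X n \<inter> space M)"
  have pos: "0 < prob (Z n -` ?X n \<inter> space M)" if n: "n \<in> {1..N}" for n
  proof -
    have ge: "Z n -` {2..} \<inter> space M = {\<omega> \<in> space M. 2 \<le> Z n \<omega>}"
      by auto
    have lt: "Z n -` {..<2} \<inter> space M = space M - {\<omega> \<in> space M. 2 \<le> Z n \<omega>}"
      by auto
    have "0 < std_normal_density (2 + 1)"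
      by (rule normal_density_pos) simp
    then have 1: "0 < prob (Z n -` {2..} \<inter> space M)"
      using prob_Z_ge[OF n, of 2] unfolding ge by simp
    \<comment> \<open>Markov's inequality at threshold 2 gives at most 1/2, so staying below 2 has
      positive probability.\<close>
    have "prob {\<omega> \<in> space M. 2 \<le> Z n \<omega>} \<le> prob {\<omega> \<in> space M. 2 \<le> \<bar>Z n \<omega>\<bar>}"
      using n by (intro finite_measure_mono) auto
    also have "\<dots> \<le> expectation (\<lambda>\<omega>. \<bar>Z n \<omega>\<bar>) / 2"
      using integrable_abs_Z[OF n] by (intro integral_Markov_inequality_measure[where A="{}"]) auto
    also have "\<dots> < 1"
      using expectation_abs_Z[OF n] by simp
    finally have "0 < prob (Z n -` {..<2} \<inter> space M)"
      using n unfolding lt by (subst prob_compl) auto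
    with 1 show ?thesis
      by (cases "n = N") simp_all
  qed
  have "prob A = (\<Prod>n\<in>insert N {1..m}. prob (Z n -` ?X n \<inter> space M))"
    unfolding A_def by (rule indep_varsD[OF indep]) (use m in auto)
  also have "\<dots> > 0"
    using m by (intro prod_pos pos) auto
  finally have "emeasure M A \<noteq> 0"
    by (simp add: emeasure_eq_measure)
  moreover have "A \<in> sets M"
    unfolding A_def using m by (intro sets.finite_INT measurable_sets[OF Z_measurable]) auto
  moreover have "sub.Z_max \<omega> < Z_max \<omega>" if "\<omega> \<in> A" for \<omega>
  proof -
    have "sub.Z_max \<omega> < 2"
      unfolding sub.Z_max_def using m that by (subst Max_less_iff) (auto simp: A_def split: if_splits)
    also have "2 \<le> Z N \<omega>"
      using that by (auto simp: A_def)
    also have "\<dots> \<le> Z_max \<omega>"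
      using m by (intro Z_le_Z_max) auto
    finally show ?thesis .
  qed
  moreover have "sub.Z_max \<omega> \<le> Z_max \<omega>" for \<omega>
    unfolding sub.Z_max_def Z_max_def using m by (intro Max_mono) auto
  ultimately have "expectation sub.Z_max < expectation Z_max"
    by (intro integral_less_AE[of _ _ A] sub.integrable_Z_max integrable_Z_max)
      (auto intro!: AE_I2 dest: less_imp_neq)
  then show ?thesis
    by (simp add: sub.Z_max_def[abs_def])
qed

end

section \<open>Asymptotics of the expected maximum\<close>

text \<open>Only bounds for each fixed \<open>N\<close> enter the sandwich, so every
  \<open>N\<close> may have its own probability space.\<close>

lemma expectation_Z_max_asymptotics:
  fixes M :: "nat \<Rightarrow> 'w measure" and Z :: "nat \<Rightarrow> nat \<Rightarrow> 'w \<Rightarrow> real"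
  assumes sample: "\<And>N. 1 \<le> N \<Longrightarrow> std_normal_sample (M N) (Z N) N"
  shows "(\<lambda>N. integral\<^sup>L (M N) (\<lambda>\<omega>. Max ((\<lambda>n. Z N n \<omega>) ` {1..N})) / sqrt (2 * ln (real N))) \<longlonglongrightarrow> 1"
    (is "(\<lambda>N. ?E N / _) \<longlonglongrightarrow> 1")
proof (rule tendsto_sandwich)
  let ?t = "\<lambda>N. sqrt (2 * ln (real N) - 2 * ln (ln (real N))) - 1"
  let ?l = "\<lambda>N. (?t N * (1 - exp (- (ln (real N) / sqrt (2 * pi)))) - 1) / sqrt (2 * ln (real N))"
  show "?l \<longlonglongrightarrow> 1"
    by real_asymp
  show "(\<lambda>_. 1 :: real) \<longlonglongrightarrow> 1"
    by simp
  have "\<forall>\<^sub>F N in sequentially. 0 \<le> ?t N"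
    by real_asymp
  moreover have "\<forall>\<^sub>F N in sequentially. 0 < ln (real N)"
    by real_asymp
  \<comment> \<open>The explicit lower bound is available only under these conditions, which hold
    for all large \<open>N\<close>.\<close>
  ultimately have ev: "\<forall>\<^sub>F N in sequentially. 1 \<le> N \<and> 0 \<le> ?t N \<and> 0 < ln (real N)"
    using eventually_ge_at_top[of 1] by eventually_elim auto
  show "\<forall>\<^sub>F N in sequentially. ?l N \<le> ?E N / sqrt (2 * ln (real N))"
    using ev
  proof eventually_elim
    case (elim N)
    interpret std_normal_sample "M N" "Z N" N
      using sample elim by blast
    show ?case
      using elim expectation_Z_max_ge_explicit by (intro divide_right_mono) (auto simp: Z_max_def[abs_def])
  qed
  show "\<forall>\<^sub>F N in sequentially. ?E N / sqrt (2 * ln (real N)) \<le> 1"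
    using ev
  proof eventually_elim
    case (elim N)
    interpret std_normal_sample "M N" "Z N" N
      using sample elim by blast
    show ?case
      using elim expectation_Z_max_le by (simp add: Z_max_def[abs_def])
  qed
qed

section \<open>Best-of-N search\<close>

lemma
  assumes "0 \<le> v"
  shows integrable_gaussian_law: "integrable (gaussian_law 0 v) (\<lambda>x. x)"
    and expectation_gaussian_law: "(\<integral>x. x \<partial>gaussian_law 0 v) = 0"
    and integrable_gaussian_law_square: "integrable (gaussian_law 0 v) (\<lambda>x. x\<^sup>2)"
    and expectation_gaussian_law_square: "(\<integral>x. x\<^sup>2 \<partial>gaussian_law 0 v) = v"
proof -
  consider "v = 0" | "0 < v"
    using assms by linarith
  then have "integrable (gaussian_law 0 v) (\<lambda>x. x) \<and> (\<integral>x. x \<partial>gaussian_law 0 v) = 0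
      \<and> integrable (gaussian_law 0 v) (\<lambda>x. x\<^sup>2) \<and> (\<integral>x. x\<^sup>2 \<partial>gaussian_law 0 v) = v"
  proof cases
    case 1
    then show ?thesis
      by (auto simp: gaussian_law_def integral_return integrable_iff_bounded nn_integral_return)
  next
    case 2
    then have s: "0 < sqrt v"
      by simp
    show ?thesis
      using 2 integrable_normal_moment[OF s, of 0 1] integral_normal_moment_odd[OF s, of 0 0]
        integrable_normal_moment[OF s, of 0 2] integral_normal_moment_even[OF s, of 0 1]
      by (simp add: gaussian_law_def integrable_density integral_density)
  qed
  then show "integrable (gaussian_law 0 v) (\<lambda>x. x)" "(\<integral>x. x \<partial>gaussian_law 0 v) = 0"
    "integrable (gaussian_law 0 v) (\<lambda>x. x\<^sup>2)" "(\<integral>x. x\<^sup>2 \<partial>gaussian_law 0 v) = v"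
    by auto
qed

section \<open>Existence and measurability of the selected index\<close>

text \<open>This form exposes that the choice depends on the set of maximisers only, which underlies
  both the congruence rule and measurability.\<close>

lemma arg_max_on_eq_SOME:
  fixes f :: "'i \<Rightarrow> 'a::linorder"
  shows "arg_max_on f S = (SOME i. i \<in> {i \<in> S. \<forall>j\<in>S. f j \<le> f i})"
  by (simp add: arg_max_on_def arg_max_def is_arg_max_linorder Ball_def)

lemma arg_max_on_in:
  fixes f :: "'i \<Rightarrow> 'a::linorder"
  assumes "finite S" "S \<noteq> {}"
  shows "arg_max_on f S \<in> S"
proof -
  obtain i where "i \<in> S" "f i = Max (f ` S)"
    using Max_in[of "f ` S"] assms by (simp add: image_iff) metis
  then have "i \<in> {i \<in> S. \<forall>j\<in>S. f j \<le> f i}"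
    using assms by auto
  then show ?thesis
    unfolding arg_max_on_eq_SOME by (rule someI2) auto
qed

lemma arg_max_on_cong:
  fixes f g :: "'i \<Rightarrow> 'a::linorder"
  assumes "\<And>i. i \<in> S \<Longrightarrow> f i = g i"
  shows "arg_max_on f S = arg_max_on g S"
proof -
  have "{i \<in> S. \<forall>j\<in>S. f j \<le> f i} = {i \<in> S. \<forall>j\<in>S. g j \<le> g i}"
    using assms by auto
  then show ?thesis
    by (simp add: arg_max_on_eq_SOME)
qed

text \<open>The choice among ties factors through the finite-valued set of maximisers.\<close>

lemma pred_arg_max_on_eq:
  fixes X :: "'i \<Rightarrow> 'a \<Rightarrow> real"
  assumes S: "finite S" and X [measurable]: "\<And>i. i \<in> S \<Longrightarrow> X i \<in> borel_measurable M"
  shows "Measurable.pred M (\<lambda>\<omega>. arg_max_on (\<lambda>i. X i \<omega>) S = n)"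
proof -
  \<comment> \<open>Ranging over the finitely many candidate sets \<open>A\<close> whose chosen
    element is \<open>n\<close> makes the event a finite Boolean combination of comparisons.\<close>
  have eq: "arg_max_on (\<lambda>i. X i \<omega>) S = n \<longleftrightarrow>
      (\<exists>A\<in>{A \<in> Pow S. (SOME i. i \<in> A) = n}. \<forall>i\<in>S. i \<in> A \<longleftrightarrow> (\<forall>j\<in>S. X j \<omega> \<le> X i \<omega>))"
    (is "_ \<longleftrightarrow> ?R") for \<omega>
  proof
    assume "arg_max_on (\<lambda>i. X i \<omega>) S = n"
    then show ?R
      by (intro bexI[of _ "{i \<in> S. \<forall>j\<in>S. X j \<omega> \<le> X i \<omega>}"]) (auto simp: arg_max_on_eq_SOME)
  next
    assume ?R
    then obtain A where A: "A \<subseteq> S" "(SOME i. i \<in> A) = n" "\<forall>i\<in>S. i \<in> A \<longleftrightarrow> (\<forall>j\<in>S. X j \<omega> \<le> X i \<omega>)"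
      by auto
    then have "A = {i \<in> S. \<forall>j\<in>S. X j \<omega> \<le> X i \<omega>}"
      by auto
    then show "arg_max_on (\<lambda>i. X i \<omega>) S = n"
      using A(2) by (simp add: arg_max_on_eq_SOME)
  qed
  show ?thesis
    unfolding eq using S by (intro pred_intros_finite) (auto intro!: pred_intros_finite)
qed

section \<open>Laws of the projections and the expected best gain\<close>

locale gaussian_search =
  fixes M :: "'w measure" and \<sigma> :: real and N :: nat and \<delta> :: "nat \<Rightarrow> 'w \<Rightarrow> real^'d"
  assumes \<sigma>_pos: "0 < \<sigma>" and N_pos: "1 \<le> N" and iid: "iid_perturbations M \<sigma> N \<delta>"

sublocale gaussian_search \<subseteq> prob_space M
  using iid by (simp add: iid_perturbations_def)

context gaussian_search
begin

lemma indep_\<delta>: "indep_vars (\<lambda>_. borel) \<delta> {1..N}"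
  using iid by (simp add: iid_perturbations_def)

lemma distributed_\<delta>:
  "n \<in> {1..N} \<Longrightarrow> distributed M lborel (\<delta> n) (\<lambda>x. ennreal (mvn_density 0 (\<sigma>\<^sup>2 *\<^sub>R mat 1) x))"
  using iid by (simp add: iid_perturbations_def)

lemma \<delta>_measurable [measurable]: "n \<in> {1..N} \<Longrightarrow> \<delta> n \<in> borel_measurable M"
  using distributed_\<delta> by (simp add: distributed_def)

lemma indep_inner: "indep_vars (\<lambda>_. borel) (\<lambda>n \<omega>. a \<bullet> \<delta> n \<omega>) {1..N}"
  by (rule indep_vars_compose2[OF indep_\<delta>]) simp

lemma distr_inner:
  assumes n: "n \<in> {1..N}"
  shows "distr M borel (\<lambda>\<omega>. a \<bullet> \<delta> n \<omega>) = gaussian_law 0 (\<sigma>\<^sup>2 * (norm a)\<^sup>2)"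
proof (cases "a = 0")
  \<comment> \<open>The constant projection 0 has the point mass at 0 as its law, which is
    \<open>gaussian_law\<close> with variance 0.\<close>
  case True
  then show ?thesis
    by (simp add: gaussian_law_def)
next
  case False
  have "distr M borel (\<lambda>\<omega>. a \<bullet> \<delta> n \<omega>) = distr M lborel (\<lambda>\<omega>. a \<bullet> \<delta> n \<omega>)"
    by (rule distr_cong) auto
  also have "\<dots> = density lborel (\<lambda>x. ennreal (normal_density 0 (\<sigma> * norm a) x))"
    using distributed_inner_isotropic_gaussian[OF distributed_\<delta>[OF n] \<sigma>_pos False]
    by (simp add: distributed_def)
  finally show ?thesis
    using False \<sigma>_pos by (simp add: gaussian_law_def real_sqrt_mult)
qed

text \<open>By independence the joint law of the projections is a product measure. The right-hand
  side sees only \<open>N\<close>, \<open>\<sigma>\<close> and \<open>norm a\<close>, so it allows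
  comparison across dimensions and across probability spaces.\<close>

lemma integral_best_gain_eq_PiM:
  "integral\<^sup>L M (best_gain a N \<delta>)
    = (\<integral>y. Max (y ` {1..N}) \<partial>PiM {1..N} (\<lambda>_. gaussian_law 0 (\<sigma>\<^sup>2 * (norm a)\<^sup>2)))"
proof -
  let ?Y = "\<lambda>\<omega>. \<lambda>n\<in>{1..N}. a \<bullet> \<delta> n \<omega>"
  have "PiM {1..N} (\<lambda>_. gaussian_law 0 (\<sigma>\<^sup>2 * (norm a)\<^sup>2))
      = PiM {1..N} (\<lambda>n. distr M borel (\<lambda>\<omega>. a \<bullet> \<delta> n \<omega>))"
    by (rule PiM_cong) (simp_all add: distr_inner)
  also have "\<dots> = distr M (PiM {1..N} (\<lambda>_. borel)) ?Y"
    using indep_inner by (subst (asm) indep_vars_iff_distr_eq_PiM') (use N_pos in auto)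
  finally have "(\<integral>y. Max (y ` {1..N}) \<partial>PiM {1..N} (\<lambda>_. gaussian_law 0 (\<sigma>\<^sup>2 * (norm a)\<^sup>2)))
      = (\<integral>y. Max ((\<lambda>n. y n) ` {1..N}) \<partial>distr M (PiM {1..N} (\<lambda>_. borel)) ?Y)"
    by simp
  also have "\<dots> = (\<integral>\<omega>. Max ((\<lambda>n. ?Y \<omega> n) ` {1..N}) \<partial>M)"
    by (rule integral_distr) (auto intro!: borel_measurable_Max)
  also have "\<dots> = integral\<^sup>L M (best_gain a N \<delta>)"
    by (intro Bochner_Integration.integral_cong) (simp_all add: best_gain_def)
  finally show ?thesis ..
qed

lemma std_normal_sample_inner:
  assumes "a \<noteq> 0"
  shows "std_normal_sample M (\<lambda>n \<omega>. (a \<bullet> \<delta> n \<omega>) / (\<sigma> * norm a)) N"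
proof unfold_locales
  show "indep_vars (\<lambda>_. borel) (\<lambda>n \<omega>. (a \<bullet> \<delta> n \<omega>) / (\<sigma> * norm a)) {1..N}"
    by (rule indep_vars_compose2[OF indep_inner]) simp
  fix n assume "n \<in> {1..N}"
  from distributed_inner_isotropic_gaussian[OF distributed_\<delta>[OF this] \<sigma>_pos assms]
  show "distributed M lborel (\<lambda>\<omega>. (a \<bullet> \<delta> n \<omega>) / (\<sigma> * norm a)) (\<lambda>x. ennreal (std_normal_density x))"
    using assms \<sigma>_pos by (subst (asm) normal_standard_normal_convert) auto
qed (rule N_pos)

lemma best_gain_eq_scaled:
  assumes "a \<noteq> 0" "1 \<le> m"
  shows "best_gain a m \<delta> = (\<lambda>\<omega>. \<sigma> * norm a * Max ((\<lambda>n. (a \<bullet> \<delta> n \<omega>) / (\<sigma> * norm a)) ` {1..m}))"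
proof
  fix \<omega>
  have "mono (\<lambda>x. \<sigma> * norm a * x)"
    using \<sigma>_pos by (intro monoI mult_left_mono) auto
  from mono_Max_commute[OF this, of "(\<lambda>n. (a \<bullet> \<delta> n \<omega>) / (\<sigma> * norm a)) ` {1..m}"]
  show "best_gain a m \<delta> \<omega> = \<sigma> * norm a * Max ((\<lambda>n. (a \<bullet> \<delta> n \<omega>) / (\<sigma> * norm a)) ` {1..m})"
    using assms \<sigma>_pos by (simp add: best_gain_def image_image)
qed

lemma best_gain_zero: "1 \<le> m \<Longrightarrow> best_gain 0 m \<delta> = (\<lambda>_. 0)"
  by (auto simp: best_gain_def fun_eq_iff image_constant_conv)

lemma integrable_best_gain: "integrable M (best_gain a N \<delta>)"
proof (cases "a = 0")
  case True
  then show ?thesis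
    using N_pos by (simp add: best_gain_zero)
next
  case False
  interpret std_normal_sample M "\<lambda>n \<omega>. (a \<bullet> \<delta> n \<omega>) / (\<sigma> * norm a)" N
    using False by (rule std_normal_sample_inner)
  show ?thesis
    using integrable_Z_max unfolding best_gain_eq_scaled[OF False N_pos] Z_max_def[abs_def] by simp
qed

text \<open>Allows two budgets to be compared on one probability space.\<close>

lemma gaussian_search_fewer: "1 \<le> m \<Longrightarrow> m \<le> N \<Longrightarrow> gaussian_search M \<sigma> m \<delta>"
  using iid \<sigma>_pos by unfold_locales (auto simp: iid_perturbations_def prob_space_axioms intro: indep_vars_subset)

lemma integral_best_gain_less:
  assumes "a \<noteq> 0" and m: "1 \<le> m" "m < N"
  shows "integral\<^sup>L M (best_gain a m \<delta>) < integral\<^sup>L M (best_gain a N \<delta>)"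
proof -
  interpret std_normal_sample M "\<lambda>n \<omega>. (a \<bullet> \<delta> n \<omega>) / (\<sigma> * norm a)" N
    using assms(1) by (rule std_normal_sample_inner)
  show ?thesis
    using expectation_subsample_Max_less[OF m] assms(1) \<sigma>_pos
    unfolding best_gain_eq_scaled[OF assms(1) m(1)] best_gain_eq_scaled[OF assms(1) N_pos] Z_max_def[abs_def]
    by simp
qed

section \<open>Independence of the selection from orthogonal projections\<close>

lemma prob_inner_orthogonal:
  assumes n: "n \<in> {1..N}" and ab: "a \<bullet> b = 0" and A: "A \<in> sets borel" and B: "B \<in> sets borel"
  shows "prob {\<omega> \<in> space M. a \<bullet> \<delta> n \<omega> \<in> A \<and> b \<bullet> \<delta> n \<omega> \<in> B}
    = prob {\<omega> \<in> space M. a \<bullet> \<delta> n \<omega> \<in> A} * prob {\<omega> \<in> space M. b \<bullet> \<delta> n \<omega> \<in> B}"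
proof (cases "a = 0")
  \<comment> \<open>The event on \<open>a \<bullet> \<delta> n\<close> is the whole space or empty,
    so the product formula is immediate.\<close>
  case True
  then show ?thesis
    by (cases "0 \<in> A") (simp_all add: prob_space)
next
  case False
  from indep_varD[OF indep_var_inner_isotropic_gaussian[OF distributed_\<delta>[OF n] \<sigma>_pos False ab] A B]
  show ?thesis
    by (simp add: vimage_def Int_def conj_commute)
qed

text \<open>Samples are numbered from 1, so index 0 is free for the projection onto \<open>b\<close>.\<close>

lemma indep_inner_orthogonal:
  assumes n: "n \<in> {1..N}" and ab: "a \<bullet> b = 0"
  shows "indep_vars (\<lambda>_. borel) (\<lambda>m \<omega>. if m = 0 then b \<bullet> \<delta> n \<omega> else a \<bullet> \<delta> m \<omega>) {0..N}"
    (is "indep_vars _ ?X _")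
proof (subst indep_vars_finite[where E="\<lambda>_. sets borel"])
  show "\<forall>A\<in>{0..N} \<rightarrow> sets borel. prob (\<Inter>m\<in>{0..N}. ?X m -` A m \<inter> space M)
      = (\<Prod>m\<in>{0..N}. prob (?X m -` A m \<inter> space M))"
  proof
    fix A :: "nat \<Rightarrow> real set" assume "A \<in> {0..N} \<rightarrow> sets borel"
    then have A: "A m \<in> sets borel" if "m \<le> N" for m
      using that by auto
    have A' [measurable]: "A 0 \<in> sets borel" "\<And>m. m \<in> {1..N} \<Longrightarrow> A m \<in> sets borel"
      using A by auto
    have split: "{0..N} = insert 0 {1..N}"
      by auto
    \<comment> \<open>The constraint on \<open>b \<bullet> \<delta> n\<close> is absorbed into the
      set for sample \<open>n\<close>. Independence across samples then splits the intersection, and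
      orthogonality splits the factor of sample \<open>n\<close>.\<close>
    define C where "C m = {x. a \<bullet> x \<in> A m \<and> (m = n \<longrightarrow> b \<bullet> x \<in> A 0)}" for m
    have "(\<Inter>m\<in>{0..N}. ?X m -` A m \<inter> space M) = (\<Inter>m\<in>{1..N}. \<delta> m -` C m \<inter> space M)"
      using n unfolding split by (auto simp: C_def)
    also have "prob \<dots> = (\<Prod>m\<in>{1..N}. prob (\<delta> m -` C m \<inter> space M))"
    proof (rule indep_varsD_finite[OF indep_\<delta>])
      show "C m \<in> sets borel" if m: "m \<in> {1..N}" for m
      proof -
        have [measurable]: "A m \<in> sets borel"
          using m by (rule A')
        show ?thesis
          unfolding C_def by measurable
      qed
    qed (use N_pos in auto)
    also have "\<dots> = (\<Prod>m\<in>{1..N}. prob (?X m -` A m \<inter> space M)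
        * (if m = n then prob (?X 0 -` A 0 \<inter> space M) else 1))"
    proof (rule prod.cong[OF refl])
      fix m assume m: "m \<in> {1..N}"
      have "\<delta> m -` C m \<inter> space M
          = {\<omega> \<in> space M. a \<bullet> \<delta> m \<omega> \<in> A m \<and> (m = n \<longrightarrow> b \<bullet> \<delta> m \<omega> \<in> A 0)}"
        by (auto simp: C_def)
      then show "prob (\<delta> m -` C m \<inter> space M) = prob (?X m -` A m \<inter> space M)
          * (if m = n then prob (?X 0 -` A 0 \<inter> space M) else 1)"
        using m prob_inner_orthogonal[OF n ab A'(2)[OF n] A'(1)]
        by (auto simp: vimage_def Int_def conj_commute)
    qed
    also have "\<dots> = (\<Prod>m\<in>{0..N}. prob (?X m -` A m \<inter> space M))"
      unfolding split using n by (simp add: prod.distrib mult.commute)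
    finally show "prob (\<Inter>m\<in>{0..N}. ?X m -` A m \<inter> space M)
        = (\<Prod>m\<in>{0..N}. prob (?X m -` A m \<inter> space M))" .
  qed
  show "?X m \<in> borel_measurable M" if "m \<in> {0..N}" for m
    using that n by (cases "m = 0") auto
qed (auto simp: Int_stable_def sets.sigma_sets_eq[of borel, simplified])

text \<open>The selected index is a measurable function of the coordinates \<open>1..N\<close> of
  the independent family above, and \<open>b \<bullet> \<delta> n\<close> is its coordinate 0.
  Disjoint blocks of an independent family are independent.\<close>

lemma prob_arg_max_inner_orthogonal:
  assumes n: "n \<in> {1..N}" and ab: "a \<bullet> b = 0" and B: "B \<in> sets borel"
  shows "prob {\<omega> \<in> space M. arg_max_on (\<lambda>m. a \<bullet> \<delta> m \<omega>) {1..N} = n \<and> b \<bullet> \<delta> n \<omega> \<in> B}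
    = prob {\<omega> \<in> space M. arg_max_on (\<lambda>m. a \<bullet> \<delta> m \<omega>) {1..N} = n} * prob {\<omega> \<in> space M. b \<bullet> \<delta> n \<omega> \<in> B}"
proof -
  let ?X = "\<lambda>m \<omega>. if m = 0 then b \<bullet> \<delta> n \<omega> else a \<bullet> \<delta> m \<omega>"
  let ?P = "\<lambda>S. PiM S (\<lambda>_. borel) :: (nat \<Rightarrow> real) measure"
  define E where "E = {y \<in> space (?P {1..N}). arg_max_on y {1..N} = n}"
  define F where "F = {y \<in> space (?P {0}). y 0 \<in> B}"
  have "E \<in> sets (?P {1..N})"
    unfolding E_def using pred_arg_max_on_eq[of "{1..N}" "\<lambda>i y. y i" "?P {1..N}" n]
    by (auto simp: pred_def)
  moreover have "F \<in> sets (?P {0})"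
    unfolding F_def using B by measurable
  moreover have "indep_var (?P {1..N}) (\<lambda>\<omega>. \<lambda>m\<in>{1..N}. ?X m \<omega>) (?P {0}) (\<lambda>\<omega>. \<lambda>m\<in>{0}. ?X m \<omega>)"
    by (rule indep_var_restrict[OF indep_inner_orthogonal[OF n ab]]) auto
  ultimately have *: "prob ((\<lambda>\<omega>. (\<lambda>m\<in>{1..N}. ?X m \<omega>, \<lambda>m\<in>{0}. ?X m \<omega>)) -` (E \<times> F) \<inter> space M)
      = prob ((\<lambda>\<omega>. \<lambda>m\<in>{1..N}. ?X m \<omega>) -` E \<inter> space M) * prob ((\<lambda>\<omega>. \<lambda>m\<in>{0}. ?X m \<omega>) -` F \<inter> space M)"
    by (intro indep_varD) auto
  have argmax: "arg_max_on (\<lambda>m\<in>{1..N}. ?X m \<omega>) {1..N} = arg_max_on (\<lambda>m. a \<bullet> \<delta> m \<omega>) {1..N}" for \<omega>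
    by (rule arg_max_on_cong) auto
  have E: "(\<lambda>m\<in>{1..N}. ?X m \<omega>) \<in> E \<longleftrightarrow> arg_max_on (\<lambda>m. a \<bullet> \<delta> m \<omega>) {1..N} = n" for \<omega>
    unfolding E_def mem_Collect_eq argmax by (simp add: space_PiM)
  have F: "(\<lambda>m\<in>{0}. ?X m \<omega>) \<in> F \<longleftrightarrow> b \<bullet> \<delta> n \<omega> \<in> B" for \<omega>
    by (simp add: F_def space_PiM)
  from * show ?thesis
    unfolding vimage_def mem_Times_iff fst_conv snd_conv E F by (simp add: Int_def conj_commute)
qed

lemma pred_arg_max [measurable]: "Measurable.pred M (\<lambda>\<omega>. arg_max_on (\<lambda>m. a \<bullet> \<delta> m \<omega>) {1..N} = n)"
  by (rule pred_arg_max_on_eq) auto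

lemma arg_max_in: "arg_max_on (\<lambda>m. a \<bullet> \<delta> m \<omega>) {1..N} \<in> {1..N}"
  using N_pos by (intro arg_max_on_in) auto

section \<open>Law and size of the selected orthogonal projection\<close>

lemma selected_vimage:
  "{\<omega> \<in> space M. b \<bullet> selected a N \<delta> \<omega> \<in> B}
    = (\<Union>n\<in>{1..N}. {\<omega> \<in> space M. arg_max_on (\<lambda>m. a \<bullet> \<delta> m \<omega>) {1..N} = n \<and> b \<bullet> \<delta> n \<omega> \<in> B})"
  using arg_max_in by (auto simp: selected_def)

lemma arg_max_inner_in_events:
  assumes "n \<in> {1..N}" and [measurable]: "B \<in> sets borel"
  shows "{\<omega> \<in> space M. arg_max_on (\<lambda>m. a \<bullet> \<delta> m \<omega>) {1..N} = n \<and> b \<bullet> \<delta> n \<omega> \<in> B} \<in> events"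
proof -
  have [measurable]: "\<delta> n \<in> borel_measurable M"
    using assms(1) by (rule \<delta>_measurable)
  show ?thesis
    by measurable
qed

lemma inner_selected_measurable [measurable]: "(\<lambda>\<omega>. b \<bullet> selected a N \<delta> \<omega>) \<in> borel_measurable M"
proof (rule measurableI)
  fix B :: "real set" assume [measurable]: "B \<in> sets borel"
  have "{\<omega> \<in> space M. b \<bullet> selected a N \<delta> \<omega> \<in> B} \<in> sets M"
    unfolding selected_vimage by (intro sets.finite_UN arg_max_inner_in_events) auto
  then show "(\<lambda>\<omega>. b \<bullet> selected a N \<delta> \<omega>) -` B \<inter> space M \<in> sets M"
    by (simp add: vimage_def Int_def conj_commute)
qed simp

lemma distr_inner_selected:
  assumes ab: "a \<bullet> b = 0"
  shows "distr M borel (\<lambda>\<omega>. b \<bullet> selected a N \<delta> \<omega>) = gaussian_law 0 (\<sigma>\<^sup>2 * (norm b)\<^sup>2)"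
    (is "_ = ?G")
proof (rule measure_eqI)
  have 1: "1 \<in> {1..N}"
    using N_pos by simp
  show "sets (distr M borel (\<lambda>\<omega>. b \<bullet> selected a N \<delta> \<omega>)) = sets ?G"
    by (simp flip: distr_inner[OF 1])
  fix B assume "B \<in> sets (distr M borel (\<lambda>\<omega>. b \<bullet> selected a N \<delta> \<omega>))"
  then have B [measurable]: "B \<in> sets borel"
    by simp
  let ?I = "\<lambda>n. {\<omega> \<in> space M. arg_max_on (\<lambda>m. a \<bullet> \<delta> m \<omega>) {1..N} = n}"
  \<comment> \<open>All samples share one law, so this factor is the same for every \<open>n\<close>
    and can be pulled out of the sum over the selected index.\<close>
  have G: "prob {\<omega> \<in> space M. b \<bullet> \<delta> n \<omega> \<in> B} = measure ?G B" if n: "n \<in> {1..N}" for n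
    using n by (simp add: measure_distr vimage_def Int_def conj_commute flip: distr_inner[OF n])
  have "prob {\<omega> \<in> space M. b \<bullet> selected a N \<delta> \<omega> \<in> B}
      = (\<Sum>n\<in>{1..N}. prob {\<omega> \<in> space M. arg_max_on (\<lambda>m. a \<bullet> \<delta> m \<omega>) {1..N} = n \<and> b \<bullet> \<delta> n \<omega> \<in> B})"
    unfolding selected_vimage
    by (intro finite_measure_finite_Union)
      (use arg_max_inner_in_events B in \<open>auto simp: disjoint_family_on_def\<close>)
  also have "\<dots> = (\<Sum>n\<in>{1..N}. prob (?I n)) * measure ?G B"
    by (simp add: prob_arg_max_inner_orthogonal[OF _ ab B] G sum_distrib_right del: One_nat_def)
  also have "(\<Sum>n\<in>{1..N}. prob (?I n)) = prob (\<Union>n\<in>{1..N}. ?I n)"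
    by (intro finite_measure_finite_Union[symmetric])
      (use arg_max_inner_in_events[of _ UNIV] in \<open>auto simp: disjoint_family_on_def\<close>)
  also have "(\<Union>n\<in>{1..N}. ?I n) = space M"
    using arg_max_in by auto
  finally have "prob {\<omega> \<in> space M. b \<bullet> selected a N \<delta> \<omega> \<in> B} = measure ?G B"
    by (simp add: prob_space)
  \<comment> \<open>Finiteness lifts the equality of real-valued measures to
    \<open>emeasure\<close>.\<close>
  moreover have "finite_measure ?G"
    by (subst distr_inner[OF 1, symmetric]) (use 1 in \<open>auto intro!: finite_measure_distr\<close>)
  ultimately show "emeasure (distr M borel (\<lambda>\<omega>. b \<bullet> selected a N \<delta> \<omega>)) B = emeasure ?G B"
    by (simp add: emeasure_distr emeasure_eq_measure finite_measure.emeasure_eq_measure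
        vimage_def Int_def conj_commute)
qed

lemma
  assumes ab: "a \<bullet> b = 0"
  shows integrable_inner_selected: "integrable M (\<lambda>\<omega>. b \<bullet> selected a N \<delta> \<omega>)"
    and expectation_inner_selected: "expectation (\<lambda>\<omega>. b \<bullet> selected a N \<delta> \<omega>) = 0"
    and integrable_inner_selected_square: "integrable M (\<lambda>\<omega>. (b \<bullet> selected a N \<delta> \<omega>)\<^sup>2)"
    and expectation_inner_selected_square:
      "expectation (\<lambda>\<omega>. (b \<bullet> selected a N \<delta> \<omega>)\<^sup>2) = \<sigma>\<^sup>2 * (norm b)\<^sup>2"
proof -
  let ?v = "\<sigma>\<^sup>2 * (norm b)\<^sup>2"
  have v: "0 \<le> ?v"
    by simp
  note law = distr_inner_selected[OF ab, symmetric]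
  show "integrable M (\<lambda>\<omega>. b \<bullet> selected a N \<delta> \<omega>)"
    using integrable_gaussian_law[OF v] unfolding law by (subst (asm) integrable_distr_eq) auto
  show "expectation (\<lambda>\<omega>. b \<bullet> selected a N \<delta> \<omega>) = 0"
    using expectation_gaussian_law[OF v] unfolding law by (subst (asm) integral_distr) auto
  show "integrable M (\<lambda>\<omega>. (b \<bullet> selected a N \<delta> \<omega>)\<^sup>2)"
    using integrable_gaussian_law_square[OF v] unfolding law by (subst (asm) integrable_distr_eq) auto
  show "expectation (\<lambda>\<omega>. (b \<bullet> selected a N \<delta> \<omega>)\<^sup>2) = ?v"
    using expectation_gaussian_law_square[OF v] unfolding law by (subst (asm) integral_distr) auto
qed

text \<open>This is Chebyshev's inequality: \<open>\<sigma> * norm b\<close> is the standard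
  deviation of the selected projection.\<close>

lemma prob_inner_selected_gt:
  assumes ab: "a \<bullet> b = 0" and t: "0 < t"
  shows "prob {\<omega> \<in> space M. t * (\<sigma> * norm b) < \<bar>b \<bullet> selected a N \<delta> \<omega>\<bar>} \<le> 1 / t\<^sup>2"
proof (cases "b = 0")
  \<comment> \<open>The event reads \<open>0 < 0\<close> because the inequality is strict, so it is
    empty.\<close>
  case True
  then show ?thesis
    by simp
next
  case False
  then have pos: "0 < t * (\<sigma> * norm b)"
    using t \<sigma>_pos by simp
  let ?Y = "\<lambda>\<omega>. b \<bullet> selected a N \<delta> \<omega>"
  have "prob {\<omega> \<in> space M. t * (\<sigma> * norm b) < \<bar>?Y \<omega>\<bar>}
      \<le> prob {\<omega> \<in> space M. t * (\<sigma> * norm b) \<le> \<bar>?Y \<omega> - expectation ?Y\<bar>}"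
    by (intro finite_measure_mono) (auto simp: expectation_inner_selected[OF ab])
  also have "\<dots> \<le> variance ?Y / (t * (\<sigma> * norm b))\<^sup>2"
    by (rule Chebyshev_inequality[OF _ integrable_inner_selected_square[OF ab] pos]) simp
  also have "\<dots> = 1 / t\<^sup>2"
    using False \<sigma>_pos t
    by (simp add: expectation_inner_selected[OF ab] expectation_inner_selected_square[OF ab] power_mult_distrib)
  finally show ?thesis .
qed

end

text \<open>The factor \<open>1 + o(1)\<close> is rendered by a remainder \<open>r\<close>,
  independence of the dimension by comparison with a search over another index type
  \<open>'e\<close>, and typical magnitude by a root mean square bound together with a tail bound
  whose constants do not involve \<open>N\<close>.\<close>

theorem theorem1:
  fixes L :: "real^'d \<Rightarrow> real" and \<theta> a :: "real^'d" and \<sigma> :: real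
    and M :: "nat \<Rightarrow> 'w measure" and \<delta> :: "nat \<Rightarrow> nat \<Rightarrow> 'w \<Rightarrow> real^'d"
  assumes gradient: "GDERIV L \<theta> :> - a"
    and expansion: "(\<lambda>h. (- L (\<theta> + h)) - (- L \<theta>) - a \<bullet> h) \<in> O[nhds 0](\<lambda>h. (norm h)\<^sup>2)"
    and scale: "0 < \<sigma>"
    and samples: "\<And>N. 1 \<le> N \<Longrightarrow> iid_perturbations (M N) \<sigma> N (\<delta> N)"
  shows
    "(\<forall>N\<ge>1. \<forall>n\<in>{1..N}.
        distr (M N) borel (\<lambda>\<omega>. a \<bullet> \<delta> N n \<omega>) = gaussian_law 0 (\<sigma>\<^sup>2 * (norm a)\<^sup>2))
     \<and>
     (\<forall>N\<ge>1. integrable (M N) (best_gain a N (\<delta> N))) \<and>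
     (\<exists>r :: nat \<Rightarrow> real. r \<longlonglongrightarrow> 0 \<and>
        (\<forall>N\<ge>1. integral\<^sup>L (M N) (best_gain a N (\<delta> N))
                 = \<sigma> * norm a * sqrt (2 * ln (real N)) * (1 + r N))) \<and>
     (a \<noteq> 0 \<longrightarrow> strict_mono_on {1..} (\<lambda>N. integral\<^sup>L (M N) (best_gain a N (\<delta> N)))) \<and>
     (\<forall>(a' :: real^'e) (M' :: 'v measure) \<delta>'. \<forall>N\<ge>1.
        norm a' = norm a \<longrightarrow> iid_perturbations M' \<sigma> N \<delta>' \<longrightarrow>
        integral\<^sup>L M' (best_gain a' N \<delta>') = integral\<^sup>L (M N) (best_gain a N (\<delta> N)))
     \<and>
     (\<forall>N\<ge>1. \<forall>b. a \<bullet> b = 0 \<longrightarrow>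
        integrable (M N) (\<lambda>\<omega>. b \<bullet> selected a N (\<delta> N) \<omega>) \<and>
        integral\<^sup>L (M N) (\<lambda>\<omega>. b \<bullet> selected a N (\<delta> N) \<omega>) = 0 \<and>
        integrable (M N) (\<lambda>\<omega>. (b \<bullet> selected a N (\<delta> N) \<omega>)\<^sup>2) \<and>
        sqrt (integral\<^sup>L (M N) (\<lambda>\<omega>. (b \<bullet> selected a N (\<delta> N) \<omega>)\<^sup>2)) \<le> \<sigma> * norm b \<and>
        (\<forall>t>0. measure (M N) {\<omega> \<in> space (M N).
                  \<bar>b \<bullet> selected a N (\<delta> N) \<omega>\<bar> > t * (\<sigma> * norm b)} \<le> 1 / t\<^sup>2))"
proof -
  have search: "gaussian_search (M N) \<sigma> N (\<delta> N)" if "1 \<le> N" for N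
    using that scale samples by unfold_locales
  let ?E = "\<lambda>N. integral\<^sup>L (M N) (best_gain a N (\<delta> N))"
  show ?thesis
  proof (intro conjI allI impI ballI)
    fix N :: nat assume N: "1 \<le> N"
    interpret gaussian_search "M N" \<sigma> N "\<delta> N"
      using N by (rule search)
    show "distr (M N) borel (\<lambda>\<omega>. a \<bullet> \<delta> N n \<omega>) = gaussian_law 0 (\<sigma>\<^sup>2 * (norm a)\<^sup>2)"
      if "n \<in> {1..N}" for n
      using that by (rule distr_inner)
    show "integrable (M N) (best_gain a N (\<delta> N))"
      by (rule integrable_best_gain)
    show "integral\<^sup>L M' (best_gain a' N \<delta>') = ?E N"
      if norm: "norm a' = norm a" and iid': "iid_perturbations M' \<sigma> N \<delta>'"
      for a' :: "real^'e" and M' :: "'v measure" and \<delta>'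
    proof -
      interpret other: gaussian_search M' \<sigma> N \<delta>'
        using scale N iid' by unfold_locales
      \<comment> \<open>Both sides equal the same integral over the product law.\<close>
      show ?thesis
        by (simp only: other.integral_best_gain_eq_PiM integral_best_gain_eq_PiM norm)
    qed
    fix b assume ab: "a \<bullet> b = 0"
    show "integrable (M N) (\<lambda>\<omega>. b \<bullet> selected a N (\<delta> N) \<omega>)"
      "integral\<^sup>L (M N) (\<lambda>\<omega>. b \<bullet> selected a N (\<delta> N) \<omega>) = 0"
      "integrable (M N) (\<lambda>\<omega>. (b \<bullet> selected a N (\<delta> N) \<omega>)\<^sup>2)"
      using ab by (rule integrable_inner_selected expectation_inner_selected integrable_inner_selected_square)+
    show "sqrt (integral\<^sup>L (M N) (\<lambda>\<omega>. (b \<bullet> selected a N (\<delta> N) \<omega>)\<^sup>2)) \<le> \<sigma> * norm b"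
      using scale by (simp add: expectation_inner_selected_square[OF ab] real_sqrt_mult)
    show "measure (M N) {\<omega> \<in> space (M N). \<bar>b \<bullet> selected a N (\<delta> N) \<omega>\<bar> > t * (\<sigma> * norm b)} \<le> 1 / t\<^sup>2"
      if "0 < t" for t
      using ab that by (rule prob_inner_selected_gt)
  next
    let ?s = "\<lambda>N. sqrt (2 * ln (real N))"
    show "strict_mono_on {1..} ?E" if "a \<noteq> 0"
    proof (rule strict_mono_onI)
      fix m N :: nat assume m: "m \<in> {1..}" and "N \<in> {1..}" and mN: "m < N"
      interpret gaussian_search "M N" \<sigma> N "\<delta> N"
        using \<open>N \<in> {1..}\<close> by (intro search) auto
      interpret fewer: gaussian_search "M N" \<sigma> m "\<delta> N"
        using m mN by (intro gaussian_search_fewer) auto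
      interpret other: gaussian_search "M m" \<sigma> m "\<delta> m"
        using m by (intro search) auto
      \<comment> \<open>The budgets \<open>m\<close> and \<open>N\<close> come with different
        spaces. The expected gain depends on the law only, so the one for \<open>m\<close> can be
        computed from the first \<open>m\<close> samples of the space for \<open>N\<close>.\<close>
      have "?E m = integral\<^sup>L (M N) (best_gain a m (\<delta> N))"
        by (simp only: fewer.integral_best_gain_eq_PiM other.integral_best_gain_eq_PiM)
      also have "\<dots> < ?E N"
        using that m mN by (intro integral_best_gain_less) auto
      finally show "?E m < ?E N" .
    qed
    show "\<exists>r :: nat \<Rightarrow> real. r \<longlonglongrightarrow> 0 \<and> (\<forall>N\<ge>1. ?E N = \<sigma> * norm a * ?s N * (1 + r N))"
    proof (cases "a = 0")
      \<comment> \<open>Both sides vanish, so any null sequence serves as remainder.\<close>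
      case True
      have "?E N = 0" if "1 \<le> N" for N
      proof -
        interpret gaussian_search "M N" \<sigma> N "\<delta> N"
          using that by (rule search)
        show ?thesis
          using that by (simp add: True best_gain_zero)
      qed
      then show ?thesis
        by (intro exI[of _ "\<lambda>_. 0"]) (simp add: True)
    next
      case False
      let ?Z = "\<lambda>N n \<omega>. (a \<bullet> \<delta> N n \<omega>) / (\<sigma> * norm a)"
      let ?m = "\<lambda>N. integral\<^sup>L (M N) (\<lambda>\<omega>. Max ((\<lambda>n. ?Z N n \<omega>) ` {1..N}))"
      have Z: "std_normal_sample (M N) (?Z N) N" if "1 \<le> N" for N
        using search[OF that] False by (rule gaussian_search.std_normal_sample_inner)
      have E: "?E N = \<sigma> * norm a * ?m N" if "1 \<le> N" for N
      proof -
        interpret gaussian_search "M N" \<sigma> N "\<delta> N"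
          using that by (rule search)
        show ?thesis
          by (simp only: best_gain_eq_scaled[OF False that] integral_mult_right_zero)
      qed
      have m1: "?m 1 = 0"
      proof -
        interpret std_normal_sample "M 1" "?Z 1" 1
          by (rule Z) simp
        have "expectation (?Z 1 1) = 0"
          by (rule standard_normal_distributed_expectation) (rule std_normal, simp)
        then show ?thesis
          by simp
      qed
      \<comment> \<open>Obtained by solving the required equation for the remainder.\<close>
      define r where "r N = ?m N / ?s N - 1" for N
      have "r \<longlonglongrightarrow> 1 - 1"
        unfolding r_def by (intro tendsto_diff expectation_Z_max_asymptotics Z tendsto_const)
      moreover have "?E N = \<sigma> * norm a * ?s N * (1 + r N)" if N: "1 \<le> N" for N
      proof (cases "N = 1")
        \<comment> \<open>\<open>?s 1\<close> is 0, so the right-hand side vanishes whatever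
          \<open>r 1\<close> is; \<open>m1\<close> makes the left-hand side vanish as well.\<close>
        case True
        then show ?thesis
          using E[OF N] unfolding True m1 by simp
      next
        case False
        then have "0 < ln (real N)"
          using N by simp
        then show ?thesis
          unfolding E[OF N] by (simp add: r_def)
      qed
      ultimately show ?thesis
        by auto
    qed
  qed
qed

end
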